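(* If $F, G \colon \mathbf{Set} \to \mathbf{Set}$ are taut functors, then there is an isomorphism of functors $$\Delta[F \times G] \cong (\Delta[F] \times G) + (F \times \Delta[G]) + (\Delta[F] \times \Delta[G]).$$
   Context: A functor is taut if it preserves inverse image diagrams, i.e. pullback squares in which one leg is a monomorphism (pullbacks of a monomorphism along an arbitrary morphism). Products of taut functors are taut. For a taut functor $F \colon \mathbf{Set} \to \mathbf{Set}$ let $j_X \colon X \to X+1$ be the coproduct injection. The difference functor of $F$ is $\Delta[F](X) = F(X+1) \setminus \mathrm{Im}\, F(j_X)$; for $f \colon X \to Y$, $\Delta[F](f)$ is the restriction of $F(f+1)$ (which does restrict, because $F$ is taut). Products and coproducts of functors are pointwise. *)

theory Defs
  imports "HOL-Library.FuncSet"
begin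

text \<open>
  HOL has no type of all sets, so the category of sets is taken relative to a universe: a family
  of small subsets of a type \<open>'u\<close> that contains a one-element set and is closed under subsets,
  binary products and binary coproducts. As the elements of small sets all have type \<open>'u\<close>,
  products and coproducts are transported into \<open>'u\<close> along arbitrary injections. Nothing else is
  required, so that the following are instances: the small subsets of the type of all sets in a
  theory with ZFC, a Grothendieck universe, and all subsets of an arbitrary infinite type.
\<close>

record 'u set_universe =
  small :: "'u set set"
  pair_code :: "'u \<times> 'u \<Rightarrow> 'u"
  sum_code :: "'u + 'u \<Rightarrow> 'u"
  pt :: 'u

definition set_prod :: "'u set_universe \<Rightarrow> 'u set \<Rightarrow> 'u set \<Rightarrow> 'u set" where
  "set_prod S X Y = pair_code S ` (X \<times> Y)"

definition set_sum :: "'u set_universe \<Rightarrow> 'u set \<Rightarrow> 'u set \<Rightarrow> 'u set" where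
  "set_sum S X Y = sum_code S ` (X <+> Y)"

definition set_universe :: "'u set_universe \<Rightarrow> bool" where
  "set_universe S \<longleftrightarrow>
     inj (pair_code S) \<and> inj (sum_code S) \<and>
     {pt S} \<in> small S \<and>
     (\<forall>X\<in>small S. \<forall>Y. Y \<subseteq> X \<longrightarrow> Y \<in> small S) \<and>
     (\<forall>X\<in>small S. \<forall>Y\<in>small S. set_prod S X Y \<in> small S) \<and>
     (\<forall>X\<in>small S. \<forall>Y\<in>small S. set_sum S X Y \<in> small S)"

lemma set_universe_UNIV:
  assumes "infinite (UNIV :: 'u set)"
  shows "\<exists>S :: 'u set_universe. set_universe S \<and> small S = UNIV"
proof -
  let ?U = "UNIV :: 'u set"
  have "(card_of (?U \<times> ?U), card_of ?U) \<in> ordLeq"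
    by (rule ordIso_imp_ordLeq[OF card_of_Times_same_infinite[OF assms]])
  then obtain p :: "'u \<times> 'u \<Rightarrow> 'u" where p: "inj p"
    by (auto simp: card_of_ordLeq[symmetric])
  have "(card_of (?U <+> ?U), card_of ?U) \<in> ordLeq"
    by (rule ordIso_imp_ordLeq[OF card_of_Plus_infinite1[OF assms card_of_mono1]]) simp
  then obtain s :: "'u + 'u \<Rightarrow> 'u" where s: "inj s"
    by (auto simp: card_of_ordLeq[symmetric])
  have "set_universe \<lparr>small = UNIV, pair_code = p, sum_code = s, pt = undefined\<rparr>"
    using p s by (simp add: set_universe_def)
  then show ?thesis
    by (metis set_universe.select_convs(1))
qed

text \<open>
  The morphisms from \<open>X\<close> to \<open>Y\<close> are the extensional functions in \<open>X \<rightarrow>\<^sub>E Y\<close>. The following two are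
  the actions of the binary product and coproduct on morphisms
  \<open>f : X \<rightarrow> X'\<close>, \<open>g : Y \<rightarrow> Y'\<close>.
\<close>

definition prod_mor ::
  "'u set_universe \<Rightarrow> 'u set \<Rightarrow> 'u set \<Rightarrow> ('u \<Rightarrow> 'u) \<Rightarrow> ('u \<Rightarrow> 'u) \<Rightarrow> 'u \<Rightarrow> 'u" where
  "prod_mor S X Y f g =
     (\<lambda>z\<in>set_prod S X Y. pair_code S (map_prod f g (inv (pair_code S) z)))"

definition sum_mor ::
  "'u set_universe \<Rightarrow> 'u set \<Rightarrow> 'u set \<Rightarrow> ('u \<Rightarrow> 'u) \<Rightarrow> ('u \<Rightarrow> 'u) \<Rightarrow> 'u \<Rightarrow> 'u" where
  "sum_mor S X Y f g =
     (\<lambda>z\<in>set_sum S X Y. sum_code S (map_sum f g (inv (sum_code S) z)))"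

definition mono_mor :: "'u set_universe \<Rightarrow> 'u set \<Rightarrow> 'u set \<Rightarrow> ('u \<Rightarrow> 'u) \<Rightarrow> bool" where
  "mono_mor S X Y m \<longleftrightarrow>
     X \<in> small S \<and> Y \<in> small S \<and> m \<in> X \<rightarrow>\<^sub>E Y \<and>
     (\<forall>T\<in>small S. \<forall>a\<in>T \<rightarrow>\<^sub>E X. \<forall>b\<in>T \<rightarrow>\<^sub>E X.
        compose T m a = compose T m b \<longrightarrow> a = b)"

text \<open>
  \<open>pullback_square S P A B C p q m f\<close>: the square with \<open>p : P \<rightarrow> A\<close>, \<open>q : P \<rightarrow> B\<close>, \<open>m : A \<rightarrow> C\<close>
  and \<open>f : B \<rightarrow> C\<close> is a pullback.
\<close>

definition pullback_square ::
  "'u set_universe \<Rightarrow> 'u set \<Rightarrow> 'u set \<Rightarrow> 'u set \<Rightarrow> 'u set \<Rightarrow>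
     ('u \<Rightarrow> 'u) \<Rightarrow> ('u \<Rightarrow> 'u) \<Rightarrow> ('u \<Rightarrow> 'u) \<Rightarrow> ('u \<Rightarrow> 'u) \<Rightarrow> bool" where
  "pullback_square S P A B C p q m f \<longleftrightarrow>
     P \<in> small S \<and> A \<in> small S \<and> B \<in> small S \<and> C \<in> small S \<and>
     p \<in> P \<rightarrow>\<^sub>E A \<and> q \<in> P \<rightarrow>\<^sub>E B \<and> m \<in> A \<rightarrow>\<^sub>E C \<and> f \<in> B \<rightarrow>\<^sub>E C \<and>
     compose P m p = compose P f q \<and>
     (\<forall>T\<in>small S. \<forall>a\<in>T \<rightarrow>\<^sub>E A. \<forall>b\<in>T \<rightarrow>\<^sub>E B.
        compose T m a = compose T f b \<longrightarrow>
        (\<exists>!u. u \<in> T \<rightarrow>\<^sub>E P \<and> compose T p u = a \<and> compose T q u = b))"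

definition inverse_image_diagram ::
  "'u set_universe \<Rightarrow> 'u set \<Rightarrow> 'u set \<Rightarrow> 'u set \<Rightarrow> 'u set \<Rightarrow>
     ('u \<Rightarrow> 'u) \<Rightarrow> ('u \<Rightarrow> 'u) \<Rightarrow> ('u \<Rightarrow> 'u) \<Rightarrow> ('u \<Rightarrow> 'u) \<Rightarrow> bool" where
  "inverse_image_diagram S P A B C p q m f \<longleftrightarrow>
     pullback_square S P A B C p q m f \<and> mono_mor S A C m"

text \<open>
  An extensional function does not determine its codomain, so the action of a functor on
  morphisms also takes the domain and the codomain as arguments.
\<close>

record 'u set_functor =
  obj :: "'u set \<Rightarrow> 'u set"
  mor :: "'u set \<Rightarrow> 'u set \<Rightarrow> ('u \<Rightarrow> 'u) \<Rightarrow> 'u \<Rightarrow> 'u"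

definition is_functor :: "'u set_universe \<Rightarrow> 'u set_functor \<Rightarrow> bool" where
  "is_functor S F \<longleftrightarrow>
     (\<forall>X\<in>small S. obj F X \<in> small S) \<and>
     (\<forall>X\<in>small S. \<forall>Y\<in>small S. \<forall>f\<in>X \<rightarrow>\<^sub>E Y. mor F X Y f \<in> obj F X \<rightarrow>\<^sub>E obj F Y) \<and>
     (\<forall>X\<in>small S. mor F X X (\<lambda>x\<in>X. x) = (\<lambda>a\<in>obj F X. a)) \<and>
     (\<forall>X\<in>small S. \<forall>Y\<in>small S. \<forall>Z\<in>small S. \<forall>f\<in>X \<rightarrow>\<^sub>E Y. \<forall>g\<in>Y \<rightarrow>\<^sub>E Z.
        mor F X Z (compose X g f) = compose (obj F X) (mor F Y Z g) (mor F X Y f))"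

definition taut_functor :: "'u set_universe \<Rightarrow> 'u set_functor \<Rightarrow> bool" where
  "taut_functor S F \<longleftrightarrow>
     is_functor S F \<and>
     (\<forall>P A B C p q m f. inverse_image_diagram S P A B C p q m f \<longrightarrow>
        inverse_image_diagram S (obj F P) (obj F A) (obj F B) (obj F C)
          (mor F P A p) (mor F P B q) (mor F A C m) (mor F B C f))"

definition nat_trans ::
  "'u set_universe \<Rightarrow> 'u set_functor \<Rightarrow> 'u set_functor \<Rightarrow> ('u set \<Rightarrow> 'u \<Rightarrow> 'u) \<Rightarrow> bool" where
  "nat_trans S F G \<eta> \<longleftrightarrow>
     (\<forall>X\<in>small S. \<eta> X \<in> obj F X \<rightarrow>\<^sub>E obj G X) \<and>
     (\<forall>X\<in>small S. \<forall>Y\<in>small S. \<forall>f\<in>X \<rightarrow>\<^sub>E Y.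
        compose (obj F X) (\<eta> Y) (mor F X Y f) = compose (obj F X) (mor G X Y f) (\<eta> X))"

definition functor_iso :: "'u set_universe \<Rightarrow> 'u set_functor \<Rightarrow> 'u set_functor \<Rightarrow> bool" where
  "functor_iso S F G \<longleftrightarrow>
     is_functor S F \<and> is_functor S G \<and>
     (\<exists>\<eta> \<theta>. nat_trans S F G \<eta> \<and> nat_trans S G F \<theta> \<and>
        (\<forall>X\<in>small S. compose (obj F X) (\<theta> X) (\<eta> X) = (\<lambda>a\<in>obj F X. a) \<and>
                      compose (obj G X) (\<eta> X) (\<theta> X) = (\<lambda>b\<in>obj G X. b)))"

definition prod_functor ::
  "'u set_universe \<Rightarrow> 'u set_functor \<Rightarrow> 'u set_functor \<Rightarrow> 'u set_functor" where
  "prod_functor S F G =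
     \<lparr>obj = (\<lambda>X. set_prod S (obj F X) (obj G X)),
      mor = (\<lambda>X Y f. prod_mor S (obj F X) (obj G X) (mor F X Y f) (mor G X Y f))\<rparr>"

definition sum_functor ::
  "'u set_universe \<Rightarrow> 'u set_functor \<Rightarrow> 'u set_functor \<Rightarrow> 'u set_functor" where
  "sum_functor S F G =
     \<lparr>obj = (\<lambda>X. set_sum S (obj F X) (obj G X)),
      mor = (\<lambda>X Y f. sum_mor S (obj F X) (obj G X) (mor F X Y f) (mor G X Y f))\<rparr>"

text \<open>The set \<open>X + 1\<close>, the morphism \<open>f + 1\<close> for \<open>f\<close> with domain \<open>X\<close>, and \<open>j\<^sub>X : X \<rightarrow> X + 1\<close>.\<close>

definition plus_one :: "'u set_universe \<Rightarrow> 'u set \<Rightarrow> 'u set" where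
  "plus_one S X = set_sum S X {pt S}"

definition plus_one_mor :: "'u set_universe \<Rightarrow> 'u set \<Rightarrow> ('u \<Rightarrow> 'u) \<Rightarrow> 'u \<Rightarrow> 'u" where
  "plus_one_mor S X f = sum_mor S X {pt S} f (\<lambda>x\<in>{pt S}. x)"

definition plus_one_inj :: "'u set_universe \<Rightarrow> 'u set \<Rightarrow> 'u \<Rightarrow> 'u" where
  "plus_one_inj S X = (\<lambda>x\<in>X. sum_code S (Inl x))"

definition diff_obj :: "'u set_universe \<Rightarrow> 'u set_functor \<Rightarrow> 'u set \<Rightarrow> 'u set" where
  "diff_obj S F X =
     obj F (plus_one S X) - mor F X (plus_one S X) (plus_one_inj S X) ` obj F X"

definition diff_functor :: "'u set_universe \<Rightarrow> 'u set_functor \<Rightarrow> 'u set_functor" where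
  "diff_functor S F =
     \<lparr>obj = diff_obj S F,
      mor = (\<lambda>X Y f. restrict
               (mor F (plus_one S X) (plus_one S Y) (plus_one_mor S X f)) (diff_obj S F X))\<rparr>"

end

theory Submission
  imports Defs
begin

text \<open>
  A taut functor preserves the pullback of \<open>j\<^sub>Y\<close> along \<open>f + 1\<close>, which is \<open>j\<^sub>X\<close>. Hence \<open>F j\<^sub>X\<close> is injective,
  and \<open>F (f + 1)\<close> preserves and reflects membership in the images of \<open>F j\<^sub>X\<close> and \<open>F j\<^sub>Y\<close>. A pair in
  \<open>F (X + 1) \<times> G (X + 1)\<close> lies outside the image of \<open>F j\<^sub>X \<times> G j\<^sub>X\<close> iff only its first, only its second or both
  components lie outside the respective images; these three disjoint cases are natural in \<open>X\<close> and
  give the three summands.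
\<close>

section \<open>Functors and their isomorphisms in terms of elements\<close>

lemma is_functorI:
  assumes "\<And>X. X \<in> small S \<Longrightarrow> obj F X \<in> small S"
    and mor: "\<And>X Y f. \<lbrakk>X \<in> small S; Y \<in> small S; f \<in> X \<rightarrow>\<^sub>E Y\<rbrakk> \<Longrightarrow> mor F X Y f \<in> obj F X \<rightarrow>\<^sub>E obj F Y"
    and id: "\<And>X a. \<lbrakk>X \<in> small S; a \<in> obj F X\<rbrakk> \<Longrightarrow> mor F X X (\<lambda>x\<in>X. x) a = a"
    and comp: "\<And>X Y Z f g a. \<lbrakk>X \<in> small S; Y \<in> small S; Z \<in> small S; f \<in> X \<rightarrow>\<^sub>E Y; g \<in> Y \<rightarrow>\<^sub>E Z; a \<in> obj F X\<rbrakk>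
      \<Longrightarrow> mor F X Z (compose X g f) a = mor F Y Z g (mor F X Y f a)"
  shows "is_functor S F"
  unfolding is_functor_def
proof (intro conjI ballI)
  fix X assume X: "X \<in> small S"
  \<comment> \<open>Both sides are extensional on \<open>obj F X\<close>, so the equation of
    functions reduces to the pointwise hypothesis \<open>id\<close>. The composition law is treated
    the same way.\<close>
  have "mor F X X (\<lambda>x\<in>X. x) \<in> extensional (obj F X)"
    using mor[OF X X, of "\<lambda>x\<in>X. x"] by (auto simp: PiE_def)
  then show "mor F X X (\<lambda>x\<in>X. x) = (\<lambda>a\<in>obj F X. a)"
    by (rule extensionalityI[OF _ restrict_extensional]) (simp add: id X)
next
  fix X Y Z f g
  assume A: "X \<in> small S" "Y \<in> small S" "Z \<in> small S" "f \<in> X \<rightarrow>\<^sub>E Y" "g \<in> Y \<rightarrow>\<^sub>E Z"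
  have "compose X g f \<in> X \<rightarrow>\<^sub>E Z"
    using A by (auto simp: compose_def)
  then have "mor F X Z (compose X g f) \<in> extensional (obj F X)"
    using mor A by (auto simp: PiE_def)
  then show "mor F X Z (compose X g f) = compose (obj F X) (mor F Y Z g) (mor F X Y f)"
    by (rule extensionalityI[OF _ compose_extensional]) (simp add: comp[OF A] compose_eq)
qed (use assms in auto)

lemma functor_small: "\<lbrakk>is_functor S F; X \<in> small S\<rbrakk> \<Longrightarrow> obj F X \<in> small S"
  by (simp add: is_functor_def)

lemma functor_mor:
  "\<lbrakk>is_functor S F; X \<in> small S; Y \<in> small S; f \<in> X \<rightarrow>\<^sub>E Y\<rbrakk> \<Longrightarrow> mor F X Y f \<in> obj F X \<rightarrow>\<^sub>E obj F Y"
  by (simp add: is_functor_def)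

lemma functor_mor_mem:
  "\<lbrakk>is_functor S F; X \<in> small S; Y \<in> small S; f \<in> X \<rightarrow>\<^sub>E Y; a \<in> obj F X\<rbrakk> \<Longrightarrow> mor F X Y f a \<in> obj F Y"
  by (rule PiE_mem[OF functor_mor])

lemma functor_id:
  "\<lbrakk>is_functor S F; X \<in> small S; a \<in> obj F X\<rbrakk> \<Longrightarrow> mor F X X (\<lambda>x\<in>X. x) a = a"
  by (simp add: is_functor_def)

lemma functor_comp:
  "\<lbrakk>is_functor S F; X \<in> small S; Y \<in> small S; Z \<in> small S; f \<in> X \<rightarrow>\<^sub>E Y; g \<in> Y \<rightarrow>\<^sub>E Z; a \<in> obj F X\<rbrakk>
    \<Longrightarrow> mor F X Z (compose X g f) a = mor F Y Z g (mor F X Y f a)"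
  by (simp add: is_functor_def compose_eq)

lemma functor_iso_sym: "functor_iso S F G \<Longrightarrow> functor_iso S G F"
  unfolding functor_iso_def by blast

text \<open>The pointwise inverse of a natural bijection is natural, so a single family given by its
  values is enough. Restricting it and its inverse supplies the extensionality that
  \<open>nat_trans\<close> demands.\<close>

lemma functor_iso_bijI:
  assumes F: "is_functor S F" and G: "is_functor S G"
    and bij: "\<And>X. X \<in> small S \<Longrightarrow> bij_betw (\<eta> X) (obj F X) (obj G X)"
    and nat: "\<And>X Y f a. \<lbrakk>X \<in> small S; Y \<in> small S; f \<in> X \<rightarrow>\<^sub>E Y; a \<in> obj F X\<rbrakk>
      \<Longrightarrow> \<eta> Y (mor F X Y f a) = mor G X Y f (\<eta> X a)"
  shows "functor_iso S F G"
proof -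
  let ?\<eta> = "\<lambda>X. restrict (\<eta> X) (obj F X)"
  let ?\<theta> = "\<lambda>X. restrict (inv_into (obj F X) (\<eta> X)) (obj G X)"
  have \<eta>: "\<eta> X a \<in> obj G X" if "X \<in> small S" "a \<in> obj F X" for X a
    using bij that by (auto dest: bij_betwE)
  have \<theta>: "inv_into (obj F X) (\<eta> X) b \<in> obj F X" if "X \<in> small S" "b \<in> obj G X" for X b
    using bij_betwE[OF bij_betw_inv_into[OF bij]] that by blast
  have \<theta>\<eta>: "inv_into (obj F X) (\<eta> X) (\<eta> X a) = a" if "X \<in> small S" "a \<in> obj F X" for X a
    using bij_betw_inv_into_left[OF bij] that by blast
  have \<eta>\<theta>: "\<eta> X (inv_into (obj F X) (\<eta> X) b) = b" if "X \<in> small S" "b \<in> obj G X" for X b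
    using bij_betw_inv_into_right[OF bij] that by blast
  have "nat_trans S F G ?\<eta>"
    unfolding nat_trans_def
    by (auto simp: \<eta> nat compose_def functor_mor_mem[OF F] intro!: restrict_ext)
  moreover have "nat_trans S G F ?\<theta>"
    unfolding nat_trans_def
  proof (intro conjI ballI)
    fix X Y f assume A: "X \<in> small S" "Y \<in> small S" "f \<in> X \<rightarrow>\<^sub>E Y"
    show "compose (obj G X) (?\<theta> Y) (mor G X Y f) = compose (obj G X) (mor F X Y f) (?\<theta> X)"
      unfolding compose_def
    proof (rule restrict_ext)
      fix b assume b: "b \<in> obj G X"
      let ?a = "inv_into (obj F X) (\<eta> X) b"
      \<comment> \<open>This is naturality of \<open>\<eta>\<close> at the preimage
        \<open>?a\<close> of \<open>b\<close>. Applying the inverse of \<open>\<eta> Y\<close> to it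
        yields naturality of the inverse.\<close>
      have "mor G X Y f b = \<eta> Y (mor F X Y f ?a)"
        using nat[OF A, of ?a] \<theta> \<eta>\<theta> A b by simp
      then show "?\<theta> Y (mor G X Y f b) = mor F X Y f (?\<theta> X b)"
        using \<theta>\<eta> \<eta> \<theta> functor_mor_mem[OF F A] A b by simp
    qed
  qed (auto simp: \<theta>)
  moreover have "compose (obj F X) (?\<theta> X) (?\<eta> X) = (\<lambda>a\<in>obj F X. a)"
      "compose (obj G X) (?\<eta> X) (?\<theta> X) = (\<lambda>b\<in>obj G X. b)" if "X \<in> small S" for X
    using that by (auto simp: compose_def \<eta> \<theta> \<eta>\<theta> \<theta>\<eta> intro!: restrict_ext)
  ultimately show ?thesis
    unfolding functor_iso_def using F G by blast
qed

section \<open>Elements of encoded products and coproducts\<close>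

lemma set_prod_cases:
  assumes "z \<in> set_prod S X Y"
  obtains a b where "z = pair_code S (a, b)" "a \<in> X" "b \<in> Y"
  using assms by (auto simp: set_prod_def)

lemma set_sum_cases:
  assumes "z \<in> set_sum S X Y"
  obtains a where "z = sum_code S (Inl a)" "a \<in> X" | b where "z = sum_code S (Inr b)" "b \<in> Y"
  using assms by (auto simp: set_sum_def)

lemma obj_prod [simp]: "obj (prod_functor S F G) X = set_prod S (obj F X) (obj G X)"
  and mor_prod [simp]: "mor (prod_functor S F G) X Y f =
    prod_mor S (obj F X) (obj G X) (mor F X Y f) (mor G X Y f)"
  and obj_sum [simp]: "obj (sum_functor S F G) X = set_sum S (obj F X) (obj G X)"
  and mor_sum [simp]: "mor (sum_functor S F G) X Y f =
    sum_mor S (obj F X) (obj G X) (mor F X Y f) (mor G X Y f)"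
  and obj_diff [simp]: "obj (diff_functor S F) X = diff_obj S F X"
  and mor_diff [simp]: "mor (diff_functor S F) X Y f =
    restrict (mor F (plus_one S X) (plus_one S Y) (plus_one_mor S X f)) (diff_obj S F X)"
  by (simp_all add: prod_functor_def sum_functor_def diff_functor_def)

context
  fixes S :: "'u set_universe"
  assumes universe: "set_universe S"
begin

text \<open>Injectivity of the encodings lets the simplifier treat them as free constructors, with
  \<open>inv\<close> as the destructor.\<close>

lemma pair_code_eq [simp]: "pair_code S p = pair_code S q \<longleftrightarrow> p = q"
  and sum_code_eq [simp]: "sum_code S s = sum_code S t \<longleftrightarrow> s = t"
  and inv_pair_code [simp]: "inv (pair_code S) (pair_code S p) = p"
  and inv_sum_code [simp]: "inv (sum_code S) (sum_code S s) = s"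
  using universe by (auto simp: set_universe_def inj_eq)

lemma pair_in_set_prod [simp]: "pair_code S (a, b) \<in> set_prod S X Y \<longleftrightarrow> a \<in> X \<and> b \<in> Y"
  and Inl_in_set_sum [simp]: "sum_code S (Inl a) \<in> set_sum S X Y \<longleftrightarrow> a \<in> X"
  and Inr_in_set_sum [simp]: "sum_code S (Inr b) \<in> set_sum S X Y \<longleftrightarrow> b \<in> Y"
  by (auto simp: set_prod_def set_sum_def)

lemma prod_mor_pair [simp]:
  "a \<in> X \<Longrightarrow> b \<in> Y \<Longrightarrow> prod_mor S X Y f g (pair_code S (a, b)) = pair_code S (f a, g b)"
  and sum_mor_Inl [simp]: "a \<in> X \<Longrightarrow> sum_mor S X Y f g (sum_code S (Inl a)) = sum_code S (Inl (f a))"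
  and sum_mor_Inr [simp]: "b \<in> Y \<Longrightarrow> sum_mor S X Y f g (sum_code S (Inr b)) = sum_code S (Inr (g b))"
  by (simp_all add: prod_mor_def sum_mor_def)

lemma pt_small: "{pt S} \<in> small S"
  and subset_small: "X \<in> small S \<Longrightarrow> Y \<subseteq> X \<Longrightarrow> Y \<in> small S"
  and set_prod_small: "X \<in> small S \<Longrightarrow> Y \<in> small S \<Longrightarrow> set_prod S X Y \<in> small S"
  and set_sum_small: "X \<in> small S \<Longrightarrow> Y \<in> small S \<Longrightarrow> set_sum S X Y \<in> small S"
  using universe by (auto simp: set_universe_def)

lemma plus_one_small: "X \<in> small S \<Longrightarrow> plus_one S X \<in> small S"
  by (simp add: plus_one_def set_sum_small pt_small)

lemma prod_mor_PiE:
  assumes "f \<in> X \<rightarrow>\<^sub>E X'" "g \<in> Y \<rightarrow>\<^sub>E Y'"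
  shows "prod_mor S X Y f g \<in> set_prod S X Y \<rightarrow>\<^sub>E set_prod S X' Y'"
proof (rule PiE_I)
  fix z assume "z \<in> set_prod S X Y"
  then show "prod_mor S X Y f g z \<in> set_prod S X' Y'"
    by (rule set_prod_cases) (use assms in auto)
qed (simp add: prod_mor_def)

lemma sum_mor_PiE:
  assumes "f \<in> X \<rightarrow>\<^sub>E X'" "g \<in> Y \<rightarrow>\<^sub>E Y'"
  shows "sum_mor S X Y f g \<in> set_sum S X Y \<rightarrow>\<^sub>E set_sum S X' Y'"
proof (rule PiE_I)
  fix z assume "z \<in> set_sum S X Y"
  then show "sum_mor S X Y f g z \<in> set_sum S X' Y'"
    by (rule set_sum_cases) (use assms in auto)
qed (simp add: sum_mor_def)

section \<open>Products and coproducts of functors\<close>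

lemma is_functor_prod:
  assumes F: "is_functor S F" and G: "is_functor S G"
  shows "is_functor S (prod_functor S F G)"
proof (rule is_functorI)
  fix X Y f assume "X \<in> small S" "Y \<in> small S" "f \<in> X \<rightarrow>\<^sub>E Y"
  then show "mor (prod_functor S F G) X Y f \<in> obj (prod_functor S F G) X \<rightarrow>\<^sub>E obj (prod_functor S F G) Y"
    unfolding obj_prod mor_prod by (intro prod_mor_PiE functor_mor[OF F] functor_mor[OF G])
next
  fix X a assume "X \<in> small S" "a \<in> obj (prod_functor S F G) X"
  then show "mor (prod_functor S F G) X X (\<lambda>x\<in>X. x) a = a"
    using functor_id[OF F] functor_id[OF G] by (auto elim!: set_prod_cases)
next
  fix X Y Z f g a
  assume "X \<in> small S" "Y \<in> small S" "Z \<in> small S" "f \<in> X \<rightarrow>\<^sub>E Y" "g \<in> Y \<rightarrow>\<^sub>E Z"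
    "a \<in> obj (prod_functor S F G) X"
  then show "mor (prod_functor S F G) X Z (compose X g f) a =
      mor (prod_functor S F G) Y Z g (mor (prod_functor S F G) X Y f a)"
    using functor_comp[OF F, of X Y Z f g] functor_comp[OF G, of X Y Z f g]
      functor_mor_mem[OF F, of X Y f] functor_mor_mem[OF G, of X Y f]
    by (auto elim!: set_prod_cases)
qed (simp add: set_prod_small functor_small[OF F] functor_small[OF G])

lemma is_functor_sum:
  assumes F: "is_functor S F" and G: "is_functor S G"
  shows "is_functor S (sum_functor S F G)"
proof (rule is_functorI)
  fix X Y f assume "X \<in> small S" "Y \<in> small S" "f \<in> X \<rightarrow>\<^sub>E Y"
  then show "mor (sum_functor S F G) X Y f \<in> obj (sum_functor S F G) X \<rightarrow>\<^sub>E obj (sum_functor S F G) Y"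
    unfolding obj_sum mor_sum by (intro sum_mor_PiE functor_mor[OF F] functor_mor[OF G])
next
  fix X a assume "X \<in> small S" "a \<in> obj (sum_functor S F G) X"
  then show "mor (sum_functor S F G) X X (\<lambda>x\<in>X. x) a = a"
    using functor_id[OF F] functor_id[OF G] by (auto elim!: set_sum_cases)
next
  fix X Y Z f g a
  assume "X \<in> small S" "Y \<in> small S" "Z \<in> small S" "f \<in> X \<rightarrow>\<^sub>E Y" "g \<in> Y \<rightarrow>\<^sub>E Z"
    "a \<in> obj (sum_functor S F G) X"
  then show "mor (sum_functor S F G) X Z (compose X g f) a =
      mor (sum_functor S F G) Y Z g (mor (sum_functor S F G) X Y f a)"
    using functor_comp[OF F, of X Y Z f g] functor_comp[OF G, of X Y Z f g]
      functor_mor_mem[OF F, of X Y f] functor_mor_mem[OF G, of X Y f]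
    by (auto elim!: set_sum_cases)
qed (simp add: set_sum_small functor_small[OF F] functor_small[OF G])

section \<open>The functor X + 1, its injection and its inverse image diagrams\<close>

lemma plus_one_inj_PiE: "plus_one_inj S X \<in> X \<rightarrow>\<^sub>E plus_one S X"
  by (auto simp: plus_one_inj_def plus_one_def)

lemma plus_one_mor_PiE: "f \<in> X \<rightarrow>\<^sub>E Y \<Longrightarrow> plus_one_mor S X f \<in> plus_one S X \<rightarrow>\<^sub>E plus_one S Y"
  by (auto simp: plus_one_mor_def plus_one_def intro!: sum_mor_PiE split: if_splits)

lemma plus_one_mor_id: "plus_one_mor S X (\<lambda>x\<in>X. x) = (\<lambda>x\<in>plus_one S X. x)"
proof (rule extensionalityI)
  fix z assume "z \<in> plus_one S X"
  then show "plus_one_mor S X (\<lambda>x\<in>X. x) z = (\<lambda>x\<in>plus_one S X. x) z"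
    by (auto simp: plus_one_mor_def plus_one_def elim!: set_sum_cases)
qed (simp_all add: plus_one_mor_def sum_mor_def plus_one_def)

lemma plus_one_mor_compose:
  assumes "f \<in> X \<rightarrow>\<^sub>E Y"
  shows "plus_one_mor S X (compose X g f) =
    compose (plus_one S X) (plus_one_mor S Y g) (plus_one_mor S X f)"
proof (rule extensionalityI)
  fix z assume "z \<in> plus_one S X"
  then show "plus_one_mor S X (compose X g f) z =
      compose (plus_one S X) (plus_one_mor S Y g) (plus_one_mor S X f) z"
    using PiE_mem[OF assms] by (auto simp: plus_one_mor_def plus_one_def compose_eq elim!: set_sum_cases)
qed (simp_all add: plus_one_mor_def sum_mor_def plus_one_def)

lemma plus_one_inj_natural:
  assumes "f \<in> X \<rightarrow>\<^sub>E Y"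
  shows "compose X (plus_one_mor S X f) (plus_one_inj S X) = compose X (plus_one_inj S Y) f"
  using assms by (auto simp: compose_def plus_one_inj_def plus_one_mor_def intro!: restrict_ext)

text \<open>Since f + 1 keeps the two summands apart, exactly the elements of the summand X are sent
  into the summand Y. This is the diagram to which tautness is applied.\<close>

lemma plus_one_inverse_image:
  assumes X: "X \<in> small S" and Y: "Y \<in> small S" and f: "f \<in> X \<rightarrow>\<^sub>E Y"
  shows "inverse_image_diagram S X Y (plus_one S X) (plus_one S Y)
    f (plus_one_inj S X) (plus_one_inj S Y) (plus_one_mor S X f)"
  unfolding inverse_image_diagram_def pullback_square_def mono_mor_def
proof (intro conjI ballI impI)
  fix T a b
  assume T: "T \<in> small S" and a: "a \<in> T \<rightarrow>\<^sub>E Y" and b: "b \<in> T \<rightarrow>\<^sub>E plus_one S X"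
    and eq: "compose T (plus_one_inj S Y) a = compose T (plus_one_mor S X f) b"
  \<comment> \<open>The value of f + 1 at \<open>b t\<close> is an \<open>Inl\<close>, and f + 1
    sends the added point to an \<open>Inr\<close>; hence \<open>b t\<close> itself comes from
    X.\<close>
  have "\<exists>x\<in>X. b t = sum_code S (Inl x) \<and> f x = a t" if t: "t \<in> T" for t
  proof -
    have "b t \<in> set_sum S X {pt S}"
      using b t by (auto simp: plus_one_def)
    moreover have "sum_code S (Inl (a t)) = plus_one_mor S X f (b t)"
      using fun_cong[OF eq, of t] PiE_mem[OF a t] t by (simp add: compose_eq plus_one_inj_def)
    ultimately show ?thesis
      by (auto simp: plus_one_mor_def elim!: set_sum_cases)
  qed
  then obtain u where u: "\<And>t. t \<in> T \<Longrightarrow> u t \<in> X \<and> b t = sum_code S (Inl (u t)) \<and> f (u t) = a t"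
    by metis
  show "\<exists>!u. u \<in> T \<rightarrow>\<^sub>E X \<and> compose T f u = a \<and> compose T (plus_one_inj S X) u = b"
  proof (rule ex1I[of _ "restrict u T"], intro conjI)
    show "compose T f (restrict u T) = a"
      using a u by (auto intro!: extensionalityI[of _ T] simp: compose_eq PiE_iff)
    show "compose T (plus_one_inj S X) (restrict u T) = b"
      using b u by (auto intro!: extensionalityI[of _ T] simp: compose_eq PiE_iff plus_one_inj_def)
  next
    fix v assume v: "v \<in> T \<rightarrow>\<^sub>E X \<and> compose T f v = a \<and> compose T (plus_one_inj S X) v = b"
    show "v = restrict u T"
    proof (rule extensionalityI)
      \<comment> \<open>The projection to X + 1 already determines the mediating morphism, because
        the injection of X can be cancelled.\<close>
      fix t assume t: "t \<in> T"
      then have "b t = sum_code S (Inl (v t))"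
        using v by (auto simp: compose_eq plus_one_inj_def)
      then show "v t = restrict u T t"
        using u[OF t] t by simp
    qed (use v in \<open>auto simp: PiE_def\<close>)
  qed (use u in auto)
next
  fix T a b
  assume a: "a \<in> T \<rightarrow>\<^sub>E Y" and b: "b \<in> T \<rightarrow>\<^sub>E Y"
    and eq: "compose T (plus_one_inj S Y) a = compose T (plus_one_inj S Y) b"
  show "a = b"
  proof (rule PiE_ext[OF a b])
    fix t assume t: "t \<in> T"
    then have "a t \<in> Y" "b t \<in> Y"
      using a b by auto
    then show "a t = b t"
      using fun_cong[OF eq, of t] t by (simp add: compose_eq plus_one_inj_def)
  qed
qed (use assms plus_one_small plus_one_inj_PiE plus_one_mor_PiE plus_one_inj_natural in auto)

section \<open>Monomorphisms and pullbacks in terms of elements\<close>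

lemma mono_mor_inj_on:
  assumes "mono_mor S X Y m"
  shows "inj_on m X"
proof (rule inj_onI)
  fix x y assume xy: "x \<in> X" "y \<in> X" "m x = m y"
  \<comment> \<open>Morphisms out of the one-element set represent elements, so cancelling
    \<open>m\<close> against constant morphisms gives injectivity.\<close>
  let ?c = "\<lambda>z. \<lambda>t\<in>{pt S}. z"
  have "?c x \<in> {pt S} \<rightarrow>\<^sub>E X" "?c y \<in> {pt S} \<rightarrow>\<^sub>E X" "compose {pt S} m (?c x) = compose {pt S} m (?c y)"
    using xy by (auto simp: compose_def)
  then have "?c x = ?c y"
    using assms pt_small unfolding mono_mor_def by blast
  then show "x = y"
    by (metis restrict_apply' singletonI)
qed

text \<open>The universal property is tested on the one-element set: the matching elements
  \<open>a\<close> and \<open>b\<close> become constant morphisms, and the value of the mediating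
  morphism at \<open>pt S\<close> is the required element.\<close>

lemma pullback_square_element:
  assumes pb: "pullback_square S P A B C p q m f" and "a \<in> A" "b \<in> B" "m a = f b"
  obtains u where "u \<in> P" "p u = a" "q u = b"
proof -
  let ?T = "{pt S}"
  let ?c = "\<lambda>z. \<lambda>t\<in>?T. z"
  have ab: "?c a \<in> ?T \<rightarrow>\<^sub>E A" "?c b \<in> ?T \<rightarrow>\<^sub>E B" "compose ?T m (?c a) = compose ?T f (?c b)"
    using assms by (auto simp: compose_def)
  then obtain u where u: "u \<in> ?T \<rightarrow>\<^sub>E P" "compose ?T p u = ?c a" "compose ?T q u = ?c b"
    using pb pt_small unfolding pullback_square_def by blast
  show thesis
    using that[of "u (pt S)"] u(1) fun_cong[OF u(2), of "pt S"] fun_cong[OF u(3), of "pt S"]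
    by (auto simp: compose_eq)
qed

section \<open>The difference functor and the effect of tautness\<close>

lemma is_functor_diff:
  assumes F: "is_functor S F"
    and reflects: "\<And>X Y f a. \<lbrakk>X \<in> small S; Y \<in> small S; f \<in> X \<rightarrow>\<^sub>E Y; a \<in> diff_obj S F X\<rbrakk> \<Longrightarrow>
      mor F (plus_one S X) (plus_one S Y) (plus_one_mor S X f) a \<in> diff_obj S F Y"
  shows "is_functor S (diff_functor S F)"
proof (rule is_functorI)
  fix X assume "X \<in> small S"
  then show "obj (diff_functor S F) X \<in> small S"
    by (auto simp: diff_obj_def intro: subset_small[OF functor_small[OF F plus_one_small]])
next
  fix X a assume "X \<in> small S" "a \<in> obj (diff_functor S F) X"
  then show "mor (diff_functor S F) X X (\<lambda>x\<in>X. x) a = a"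
    using functor_id[OF F] by (simp add: plus_one_mor_id plus_one_small diff_obj_def)
next
  fix X Y Z f g a
  assume "X \<in> small S" "Y \<in> small S" "Z \<in> small S" "f \<in> X \<rightarrow>\<^sub>E Y" "g \<in> Y \<rightarrow>\<^sub>E Z"
    and a: "a \<in> obj (diff_functor S F) X"
  moreover have "a \<in> obj F (plus_one S X)"
    using a by (simp add: diff_obj_def)
  ultimately show "mor (diff_functor S F) X Z (compose X g f) a =
      mor (diff_functor S F) Y Z g (mor (diff_functor S F) X Y f a)"
    using functor_comp[OF F plus_one_small plus_one_small plus_one_small plus_one_mor_PiE plus_one_mor_PiE]
    by (simp add: plus_one_mor_compose reflects)
qed (simp add: reflects)

text \<open>Tautness makes the image under \<open>F\<close> of the square in
  \<open>plus_one_inverse_image\<close> a pullback. If the value at \<open>a\<close> came from some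
  \<open>b\<close> in \<open>obj F Y\<close>, then \<open>b\<close> and \<open>a\<close> would
  match, and the pullback would give a preimage of \<open>a\<close> in \<open>obj F X\<close>,
  contradicting the choice of \<open>a\<close>.\<close>

lemma taut_functor_diff_mem:
  assumes F: "taut_functor S F" and XY: "X \<in> small S" "Y \<in> small S" "f \<in> X \<rightarrow>\<^sub>E Y"
    and a: "a \<in> diff_obj S F X"
  shows "mor F (plus_one S X) (plus_one S Y) (plus_one_mor S X f) a \<in> diff_obj S F Y"
proof -
  let ?f = "mor F (plus_one S X) (plus_one S Y) (plus_one_mor S X f)"
  have func: "is_functor S F"
    using F by (simp add: taut_functor_def)
  have pb: "pullback_square S (obj F X) (obj F Y) (obj F (plus_one S X)) (obj F (plus_one S Y))
      (mor F X Y f) (mor F X (plus_one S X) (plus_one_inj S X))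
      (mor F Y (plus_one S Y) (plus_one_inj S Y)) ?f"
    using F plus_one_inverse_image[OF XY]
    unfolding taut_functor_def inverse_image_diagram_def by blast
  have a': "a \<in> obj F (plus_one S X)"
    using a by (simp add: diff_obj_def)
  have "?f a \<noteq> mor F Y (plus_one S Y) (plus_one_inj S Y) b" if b: "b \<in> obj F Y" for b
  proof
    assume "?f a = mor F Y (plus_one S Y) (plus_one_inj S Y) b"
    then obtain u where "u \<in> obj F X" "mor F X (plus_one S X) (plus_one_inj S X) u = a"
      using pullback_square_element[OF pb b a'] by metis
    then show False
      using a by (auto simp: diff_obj_def)
  qed
  moreover have "?f a \<in> obj F (plus_one S Y)"
    using functor_mor_mem[OF func plus_one_small plus_one_small plus_one_mor_PiE] XY a' by blast
  ultimately show ?thesis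
    by (auto simp: diff_obj_def)
qed

text \<open>The injection of X is the monic leg of the diagram belonging to the identity of X. The
  image diagram is again an inverse image diagram, so this leg stays monic under
  \<open>F\<close>.\<close>

lemma taut_functor_inj_on:
  assumes F: "taut_functor S F" and X: "X \<in> small S"
  shows "inj_on (mor F X (plus_one S X) (plus_one_inj S X)) (obj F X)"
proof -
  have "inverse_image_diagram S X X (plus_one S X) (plus_one S X)
      (\<lambda>x\<in>X. x) (plus_one_inj S X) (plus_one_inj S X) (plus_one_mor S X (\<lambda>x\<in>X. x))"
    by (rule plus_one_inverse_image) (use X in auto)
  then show ?thesis
    using F mono_mor_inj_on unfolding taut_functor_def inverse_image_diagram_def by blast
qed

text \<open>Both sides are the action of \<open>F\<close> on the same composite from X to Y + 1,
  factored in two ways.\<close>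

lemma functor_plus_one_inj_natural:
  assumes F: "is_functor S F" and XY: "X \<in> small S" "Y \<in> small S" "f \<in> X \<rightarrow>\<^sub>E Y" and a: "a \<in> obj F X"
  shows "mor F (plus_one S X) (plus_one S Y) (plus_one_mor S X f)
      (mor F X (plus_one S X) (plus_one_inj S X) a) =
    mor F Y (plus_one S Y) (plus_one_inj S Y) (mor F X Y f a)"
  using functor_comp[OF F XY(1) plus_one_small[OF XY(1)] plus_one_small[OF XY(2)]
      plus_one_inj_PiE plus_one_mor_PiE[OF XY(3)] a]
    functor_comp[OF F XY(1,2) plus_one_small[OF XY(2)] XY(3) plus_one_inj_PiE a]
  by (simp add: plus_one_inj_natural[OF XY(3)])

section \<open>The difference functor of a product\<close>

lemma pair_in_diff_prod:
  "pair_code S (a, b) \<in> diff_obj S (prod_functor S F G) X \<longleftrightarrow>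
    a \<in> obj F (plus_one S X) \<and> b \<in> obj G (plus_one S X) \<and>
    (a \<in> diff_obj S F X \<or> b \<in> diff_obj S G X)"
proof -
  let ?F = "mor F X (plus_one S X) (plus_one_inj S X)"
    and ?G = "mor G X (plus_one S X) (plus_one_inj S X)"
  \<comment> \<open>The image of a product map is the product of the images, so a pair avoids it as
    soon as one of its components avoids its own image.\<close>
  have "prod_mor S (obj F X) (obj G X) ?F ?G ` set_prod S (obj F X) (obj G X) =
      set_prod S (?F ` obj F X) (?G ` obj G X)"
  proof (intro equalityI subsetI)
    fix z assume "z \<in> set_prod S (?F ` obj F X) (?G ` obj G X)"
    then obtain x y where "z = pair_code S (?F x, ?G y)" and xy: "x \<in> obj F X" "y \<in> obj G X"
      by (auto elim!: set_prod_cases)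
    then have "z = prod_mor S (obj F X) (obj G X) ?F ?G (pair_code S (x, y))"
      by simp
    then show "z \<in> prod_mor S (obj F X) (obj G X) ?F ?G ` set_prod S (obj F X) (obj G X)"
      by (rule image_eqI) (simp add: xy)
  qed (auto elim!: set_prod_cases)
  then show ?thesis
    by (auto simp: diff_obj_def)
qed

lemma diff_prod_cases:
  assumes "z \<in> diff_obj S (prod_functor S F G) X"
  obtains a b where "z = pair_code S (a, b)" "a \<in> obj F (plus_one S X)" "b \<in> obj G (plus_one S X)"
    "a \<in> diff_obj S F X \<or> b \<in> diff_obj S G X"
proof -
  have "z \<in> set_prod S (obj F (plus_one S X)) (obj G (plus_one S X))"
    using assms by (simp add: diff_obj_def)
  then show thesis
    by (rule set_prod_cases) (use assms that in \<open>auto simp: pair_in_diff_prod\<close>)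
qed

lemma is_functor_diff_prod:
  assumes F: "taut_functor S F" and G: "taut_functor S G"
  shows "is_functor S (diff_functor S (prod_functor S F G))"
proof -
  have func: "is_functor S F" "is_functor S G"
    using F G by (auto simp: taut_functor_def)
  show ?thesis
  \<comment> \<open>Preservation of the complement is checked by components: one that lies in a
    difference stays there by tautness, and the other only has to land in the value of its functor
    at Y + 1.\<close>
  proof (rule is_functor_diff[OF is_functor_prod[OF func]])
    fix X Y f z
    assume XY: "X \<in> small S" "Y \<in> small S" "f \<in> X \<rightarrow>\<^sub>E Y"
      and "z \<in> diff_obj S (prod_functor S F G) X"
    then show "mor (prod_functor S F G) (plus_one S X) (plus_one S Y) (plus_one_mor S X f) z
        \<in> diff_obj S (prod_functor S F G) Y"
      using taut_functor_diff_mem[OF F XY] taut_functor_diff_mem[OF G XY]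
        functor_mor_mem[OF func(1) plus_one_small[OF XY(1)] plus_one_small[OF XY(2)] plus_one_mor_PiE[OF XY(3)]]
        functor_mor_mem[OF func(2) plus_one_small[OF XY(1)] plus_one_small[OF XY(2)] plus_one_mor_PiE[OF XY(3)]]
      by (auto elim!: diff_prod_cases simp: pair_in_diff_prod)
  qed
qed

text \<open>
  The component at \<open>X\<close> of the isomorphism from the sum to \<open>\<Delta>[F \<times> G]\<close>: it applies \<open>F j\<^sub>X\<close> or \<open>G j\<^sub>X\<close> to the
  components that do not lie in a difference functor already.
\<close>

definition diff_prod_iso :: "'u set_functor \<Rightarrow> 'u set_functor \<Rightarrow> 'u set \<Rightarrow> 'u \<Rightarrow> 'u" where
  "diff_prod_iso F G X z =
    (case inv (sum_code S) z of
      Inl w \<Rightarrow> (case inv (sum_code S) w of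
        Inl p \<Rightarrow> pair_code S
          (map_prod id (mor G X (plus_one S X) (plus_one_inj S X)) (inv (pair_code S) p))
      | Inr p \<Rightarrow> pair_code S
          (map_prod (mor F X (plus_one S X) (plus_one_inj S X)) id (inv (pair_code S) p)))
    | Inr p \<Rightarrow> p)"

lemma diff_prod_iso_code [simp]:
  "diff_prod_iso F G X (sum_code S (Inl (sum_code S (Inl (pair_code S (a, b)))))) =
    pair_code S (a, mor G X (plus_one S X) (plus_one_inj S X) b)"
  "diff_prod_iso F G X (sum_code S (Inl (sum_code S (Inr (pair_code S (a, b)))))) =
    pair_code S (mor F X (plus_one S X) (plus_one_inj S X) a, b)"
  "diff_prod_iso F G X (sum_code S (Inr p)) = p"
  by (simp_all add: diff_prod_iso_def)

lemma bij_betw_diff_prod_iso: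
  assumes F: "taut_functor S F" and G: "taut_functor S G" and X: "X \<in> small S"
  shows "bij_betw (diff_prod_iso F G X)
    (set_sum S
      (set_sum S (set_prod S (diff_obj S F X) (obj G X)) (set_prod S (obj F X) (diff_obj S G X)))
      (set_prod S (diff_obj S F X) (diff_obj S G X)))
    (diff_obj S (prod_functor S F G) X)"
    (is "bij_betw _ ?A ?B")
proof (rule bij_betw_imageI)
  let ?F = "mor F X (plus_one S X) (plus_one_inj S X)"
    and ?G = "mor G X (plus_one S X) (plus_one_inj S X)"
  have func: "is_functor S F" "is_functor S G"
    using F G by (auto simp: taut_functor_def)
  note inj = inj_on_eq_iff[OF taut_functor_inj_on[OF F X]] inj_on_eq_iff[OF taut_functor_inj_on[OF G X]]
  \<comment> \<open>Together with \<open>memG\<close>, this separates the summands: the images of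
    elements from different summands differ in which components lie in a difference. Within a
    summand, \<open>inj\<close> settles injectivity.\<close>
  have memF: "?F a \<in> obj F (plus_one S X)" "?F a \<notin> diff_obj S F X" if "a \<in> obj F X" for a
    using that functor_mor_mem[OF func(1) X plus_one_small[OF X] plus_one_inj_PiE]
    by (auto simp: diff_obj_def)
  have memG: "?G b \<in> obj G (plus_one S X)" "?G b \<notin> diff_obj S G X" if "b \<in> obj G X" for b
    using that functor_mor_mem[OF func(2) X plus_one_small[OF X] plus_one_inj_PiE]
    by (auto simp: diff_obj_def)
  show "inj_on (diff_prod_iso F G X) ?A"
    by (intro inj_onI) (auto elim!: set_sum_cases set_prod_cases simp: memF memG inj)
  have incl: "a \<in> obj H (plus_one S X)" if "a \<in> diff_obj S H X" for a and H :: "'u set_functor"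
    using that by (simp add: diff_obj_def)
  show "diff_prod_iso F G X ` ?A = ?B"
  proof (intro equalityI subsetI)
    fix z assume "z \<in> diff_prod_iso F G X ` ?A"
    then show "z \<in> ?B"
      using memF memG by (auto elim!: set_sum_cases set_prod_cases simp: pair_in_diff_prod incl)
  next
    fix z assume "z \<in> ?B"
    then obtain a b where z: "z = pair_code S (a, b)"
      and ab: "a \<in> obj F (plus_one S X)" "b \<in> obj G (plus_one S X)"
        "a \<in> diff_obj S F X \<or> b \<in> diff_obj S G X"
      by (rule diff_prod_cases)
    \<comment> \<open>A component outside its difference has a preimage under the respective
      injection map; this preimage is the corresponding entry of the witness below.\<close>
    consider "a \<in> diff_obj S F X" "b \<in> diff_obj S G X"
      | b' where "a \<in> diff_obj S F X" "b' \<in> obj G X" "b = ?G b'"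
      | a' where "a' \<in> obj F X" "a = ?F a'" "b \<in> diff_obj S G X"
      using ab by (auto simp: diff_obj_def)
    then show "z \<in> diff_prod_iso F G X ` ?A"
    proof cases
      case 1
      then show ?thesis
        using z by (intro image_eqI[of _ _ "sum_code S (Inr z)"]) auto
    next
      case 2
      then show ?thesis
        using z by (intro image_eqI[of _ _ "sum_code S (Inl (sum_code S (Inl (pair_code S (a, b')))))"]) auto
    next
      case 3
      then show ?thesis
        using z by (intro image_eqI[of _ _ "sum_code S (Inl (sum_code S (Inr (pair_code S (a', b)))))"]) auto
    qed
  qed
qed

lemma diff_prod_functor_iso:
  assumes F: "taut_functor S F" and G: "taut_functor S G"
  shows "functor_iso S
    (diff_functor S (prod_functor S F G))
    (sum_functor S
      (sum_functor S
        (prod_functor S (diff_functor S F) G)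
        (prod_functor S F (diff_functor S G)))
      (prod_functor S (diff_functor S F) (diff_functor S G)))"
    (is "functor_iso S ?L ?R")
\<comment> \<open>The bijection is given from the sum to the difference, where applying
  \<open>F\<close> and \<open>G\<close> to the injection suffices. The opposite direction would have
  to choose preimages.\<close>
proof (rule functor_iso_sym[OF functor_iso_bijI])
  have func: "is_functor S F" "is_functor S G"
    using F G by (auto simp: taut_functor_def)
  have dfunc: "is_functor S (diff_functor S F)" "is_functor S (diff_functor S G)"
    by (auto intro: is_functor_diff func taut_functor_diff_mem F G)
  show "is_functor S ?R"
    by (intro is_functor_sum is_functor_prod func dfunc)
  show "is_functor S ?L"
    by (rule is_functor_diff_prod[OF F G])
  show "bij_betw (diff_prod_iso F G X) (obj ?R X) (obj ?L X)" if "X \<in> small S" for X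
    using bij_betw_diff_prod_iso[OF F G that] by simp
next
  fix X Y f z
  assume XY: "X \<in> small S" "Y \<in> small S" "f \<in> X \<rightarrow>\<^sub>E Y" and z: "z \<in> obj ?R X"
  have func: "is_functor S F" "is_functor S G"
    using F G by (auto simp: taut_functor_def)
  have incl: "a \<in> obj H (plus_one S X)" if "a \<in> diff_obj S H X" for a and H :: "'u set_functor"
    using that by (simp add: diff_obj_def)
  \<comment> \<open>The action of \<open>?L\<close> is a restriction, which can be evaluated only at
    an argument known to lie in the difference.\<close>
  have in_diff: "diff_prod_iso F G X z \<in> diff_obj S (prod_functor S F G) X"
    using bij_betwE[OF bij_betw_diff_prod_iso[OF F G XY(1)]] z by simp
  \<comment> \<open>Components already in a difference are moved by f + 1 on both sides. For the
    others the equation is naturality of the injection, transported by \<open>F\<close> or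
    \<open>G\<close>.\<close>
  show "diff_prod_iso F G Y (mor ?R X Y f z) = mor ?L X Y f (diff_prod_iso F G X z)"
    using z in_diff functor_plus_one_inj_natural[OF func(1) XY] functor_plus_one_inj_natural[OF func(2) XY]
      functor_mor_mem[OF func(1) XY(1) plus_one_small[OF XY(1)] plus_one_inj_PiE]
      functor_mor_mem[OF func(2) XY(1) plus_one_small[OF XY(1)] plus_one_inj_PiE]
    by (auto elim!: set_sum_cases set_prod_cases simp: incl)
qed

end

theorem theorem3p2p7:
  fixes S :: "'u set_universe" and F G :: "'u set_functor"
  assumes "set_universe S"
    and "taut_functor S F"
    and "taut_functor S G"
  shows "functor_iso S
    (diff_functor S (prod_functor S F G))
    (sum_functor S
      (sum_functor S
        (prod_functor S (diff_functor S F) G)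
        (prod_functor S F (diff_functor S G)))
      (prod_functor S (diff_functor S F) (diff_functor S G)))"
  using assms by (rule diff_prod_functor_iso)

end
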